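(* Let $G=\{1_G,\alpha,\beta,\gamma\}$ be the Klein four group acting on a finite set $X$ such that no orbit has length 4. Let $X_{\alpha,1},\dots,X_{\alpha,p}$ be the orbits of length 2 on which $\alpha$ acts trivially, $X_{\beta,1},\dots,X_{\beta,q}$ those on which $\beta$ acts trivially, and $X_{\gamma,1},\dots,X_{\gamma,r}$ those on which $\gamma$ acts trivially (any of $p,q,r$ may be 0; the remaining orbits have length 1). For $f:X\to\mathbb F_2$ let $\mu_\alpha=|\{i\le p: |f^{-1}(1)\cap X_{\alpha,i}|=1\}|$, $\mu_\beta=|\{i\le q: |f^{-1}(1)\cap X_{\beta,i}|=1\}|$, $\mu_\gamma=|\{i\le r: |f^{-1}(1)\cap X_{\gamma,i}|=1\}|$. Then: (i) there exists a $G$-perfect nonlinear function $X\to\mathbb F_2$ if and only if $8\mid |X|$ and $\min\{p,q,r\}\ge |X|/8$; (ii) a function $f:X\to\mathbb F_2$ is $G$-perfect nonlinear if and only if $\mu_\alpha=\mu_\beta=\mu_\gamma=|X|/8$.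
   Context: $\mathbb F_2$ is the additive group of order 2. A function $f:X\to\mathbb F_2$ is $G$-perfect nonlinear if $2$ divides $|X|$ and for every $\delta\in G\setminus\{1_G\}$ and every $\sigma\in\mathbb F_2$, $|\{x\in X: f(\delta x)-f(x)=\sigma\}|=|X|/2$. *)

theory Defs
  imports Complex_Main "HOL-Algebra.Group_Action" "HOL-Algebra.Elementary_Groups" "HOL-Library.Z2"
begin

definition klein_four_group :: "('g, 'm) monoid_scheme \<Rightarrow> bool" where
  "klein_four_group G \<longleftrightarrow>
     group G \<and> G \<cong> integer_mod_group 2 \<times>\<times> integer_mod_group 2"

text \<open>The type \<^typ>\<open>bit\<close> plays the role of \<open>F\<^sub>2\<close>. A function \<open>X \<rightarrow> F\<^sub>2\<close> is a
  total function on the ambient type, of which only the values on \<open>X\<close> are used.\<close>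

definition perfect_nonlinear ::
    "('g, 'm) monoid_scheme \<Rightarrow> 'x set \<Rightarrow> ('g \<Rightarrow> 'x \<Rightarrow> 'x) \<Rightarrow> ('x \<Rightarrow> bit) \<Rightarrow> bool" where
  "perfect_nonlinear G X \<phi> f \<longleftrightarrow>
     2 dvd card X \<and>
     (\<forall>\<delta>\<in>carrier G - {\<one>\<^bsub>G\<^esub>}. \<forall>\<sigma>::bit.
        real (card {x \<in> X. f (\<phi> \<delta> x) - f x = \<sigma>}) = real (card X) / 2)"

definition trivial_orbits2 ::
    "('g, 'm) monoid_scheme \<Rightarrow> 'x set \<Rightarrow> ('g \<Rightarrow> 'x \<Rightarrow> 'x) \<Rightarrow> 'g \<Rightarrow> 'x set set" where
  "trivial_orbits2 G X \<phi> g =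
     {Y \<in> orbits G X \<phi>. card Y = 2 \<and> (\<forall>x\<in>Y. \<phi> g x = x)}"

definition mu ::
    "('g, 'm) monoid_scheme \<Rightarrow> 'x set \<Rightarrow> ('g \<Rightarrow> 'x \<Rightarrow> 'x) \<Rightarrow> ('x \<Rightarrow> bit) \<Rightarrow> 'g \<Rightarrow> nat" where
  "mu G X \<phi> f g = card {Y \<in> trivial_orbits2 G X \<phi> g. card (f -` {1} \<inter> Y) = 1}"

end

theory Submission
  imports Defs
begin

text \<open>
  A non-identity element \<open>g\<close> of the Klein four group moves exactly the points of those orbits of
  length 2 on which one of the other two non-identity elements acts trivially, and it swaps the
  two points of such an orbit. Hence \<open>f (g x) \<noteq> f x\<close> holds at exactly the \<open>2 (\<mu>\<^sub>h + \<mu>\<^sub>k)\<close> points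
  of the orbits on which \<open>f\<close> is not constant, where \<open>h, k\<close> are the other two elements. Perfect
  nonlinearity thus says that the pairwise sums of \<open>\<mu>\<^sub>\<alpha>, \<mu>\<^sub>\<beta>, \<mu>\<^sub>\<gamma>\<close> all equal \<open>|X|/4\<close>, so each of
  them is \<open>|X|/8\<close>. Conversely, a function with prescribed \<open>\<mu>\<close>'s is the indicator
  of one point from each of the required number of orbits.
\<close>

text \<open>Exponent 2 is checked in the model and pulled back along the isomorphism. This is the
  form in which the isomorphism type enters the locale below, as \<open>square\<close>.\<close>

lemma klein_four_group_square:
  assumes "klein_four_group G" "x \<in> carrier G"
  shows "x \<otimes>\<^bsub>G\<^esub> x = \<one>\<^bsub>G\<^esub>"
proof -
  let ?H = "integer_mod_group 2 \<times>\<times> integer_mod_group 2"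
  interpret G: group G using assms by (simp add: klein_four_group_def)
  obtain h where h: "h \<in> iso G ?H"
    using assms by (auto simp: klein_four_group_def is_iso_def)
  have H: "group ?H" by (simp add: DirProd_group)
  have hom: "h \<in> hom G ?H" and inj: "inj_on h (carrier G)"
    using h by (auto simp: iso_def bij_betw_def)
  have sq: "y \<otimes>\<^bsub>?H\<^esub> y = \<one>\<^bsub>?H\<^esub>" for y
    by (cases y) (auto simp: mult_DirProd one_DirProd integer_mod_group_def)
  have "h (x \<otimes>\<^bsub>G\<^esub> x) = h \<one>\<^bsub>G\<^esub>"
    using hom_mult[OF hom assms(2) assms(2)] sq hom_one[OF hom G.group_axioms H] by simp
  then show ?thesis
    using inj assms(2) by (auto dest: inj_onD)
qed

text \<open>Links the condition counted by \<open>mu\<close> to a nonzero derivative of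
  \<open>f\<close> on an orbit whose two points are swapped.\<close>

lemma card_ones_on_pair_iff:
  fixes f :: "'a \<Rightarrow> bit"
  assumes "Y = {x, y}" "x \<noteq> y"
  shows "card (f -` {1} \<inter> Y) = 1 \<longleftrightarrow> f y \<noteq> f x"
proof -
  have "f -` {1} \<inter> Y = (if f x = 1 then {x} else {}) \<union> (if f y = 1 then {y} else {})"
    using assms by auto
  then show ?thesis using assms by (cases "f x"; cases "f y") auto
qed

section \<open>Orbits of a Klein four action without orbits of length 4\<close>

locale klein_four_action = group_action G X \<phi>
  for G :: "('g, 'm) monoid_scheme" (structure) and X :: "'x set" and \<phi> +
  fixes \<alpha> \<beta> \<gamma> :: 'g
  assumes carrier_eq: "carrier G = {\<one>, \<alpha>, \<beta>, \<gamma>}"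
    and distinct_elements: "distinct [\<one>, \<alpha>, \<beta>, \<gamma>]"
    and square: "g \<in> carrier G \<Longrightarrow> g \<otimes> g = \<one>"
    and finite_X: "finite X"
    and orbit_card_neq_4: "Y \<in> orbits G X \<phi> \<Longrightarrow> card Y \<noteq> 4"
begin

text \<open>The assumptions are symmetric in \<alpha>, \<beta>, \<gamma>. With \<open>swap\<close>,
  this generates all permutations, so later lemmas can be proved for one assignment of roles and
  reinterpreted for the others.\<close>

lemma rotate: "klein_four_action G X \<phi> \<beta> \<gamma> \<alpha>"
  using carrier_eq distinct_elements square finite_X orbit_card_neq_4
  by unfold_locales auto

lemma swap: "klein_four_action G X \<phi> \<alpha> \<gamma> \<beta>"
  using carrier_eq distinct_elements square finite_X orbit_card_neq_4
  by unfold_locales auto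

lemma mult_eq: "\<alpha> \<otimes> \<beta> = \<gamma>" "\<beta> \<otimes> \<alpha> = \<gamma>"
proof -
  interpret group G using group_hom group_hom.axioms(1) by blast
  have c: "\<alpha> \<in> carrier G" "\<beta> \<in> carrier G" using carrier_eq by auto
  \<comment> \<open>A product equal to the identity would give \<open>a = inv b = b\<close>; the
    values \<open>a\<close> and \<open>b\<close> are excluded by cancellation. Only the third
    non-identity element remains.\<close>
  have *: "a \<otimes> b \<in> carrier G - {\<one>, a, b}"
    if "a \<in> carrier G" "b \<in> carrier G" "a \<noteq> b" "a \<noteq> \<one>" "b \<noteq> \<one>" for a b
    using that square[of b] inv_equality[of a b] inv_equality[of b b] by auto
  show "\<alpha> \<otimes> \<beta> = \<gamma>" "\<beta> \<otimes> \<alpha> = \<gamma>"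
    using *[of \<alpha> \<beta>] *[of \<beta> \<alpha>] c distinct_elements carrier_eq by auto
qed

lemma action_comp:
  assumes "x \<in> X"
  shows "\<phi> \<alpha> (\<phi> \<alpha> x) = x" "\<phi> \<beta> (\<phi> \<beta> x) = x" "\<phi> \<gamma> (\<phi> \<gamma> x) = x"
    "\<phi> \<alpha> (\<phi> \<beta> x) = \<phi> \<gamma> x" "\<phi> \<beta> (\<phi> \<alpha> x) = \<phi> \<gamma> x" "\<phi> \<one> x = x"
proof -
  have one: "\<phi> \<one> x = x" using id_eq_one assms by (metis restrict_apply')
  have "\<phi> g (\<phi> h x) = \<phi> (g \<otimes> h) x" if "g \<in> carrier G" "h \<in> carrier G" for g h
    using composition_rule[OF assms that] by simp
  then show "\<phi> \<alpha> (\<phi> \<alpha> x) = x" "\<phi> \<beta> (\<phi> \<beta> x) = x" "\<phi> \<gamma> (\<phi> \<gamma> x) = x"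
    "\<phi> \<alpha> (\<phi> \<beta> x) = \<phi> \<gamma> x" "\<phi> \<beta> (\<phi> \<alpha> x) = \<phi> \<gamma> x" "\<phi> \<one> x = x"
    using square mult_eq carrier_eq one by auto
qed

lemma orbit_eq:
  assumes "x \<in> X"
  shows "orbit G \<phi> x = {x, \<phi> \<alpha> x, \<phi> \<beta> x, \<phi> \<gamma> x}"
  using action_comp(6)[OF assms] carrier_eq orbit_refl[OF assms] by (auto simp: orbit_def)

lemma action_closed:
  assumes "x \<in> X"
  shows "\<phi> \<alpha> x \<in> X" "\<phi> \<beta> x \<in> X" "\<phi> \<gamma> x \<in> X"
  using element_image[OF _ assms] carrier_eq by auto

lemma fixed_by_nonidentity:
  assumes "x \<in> X"
  shows "\<phi> \<alpha> x = x \<or> \<phi> \<beta> x = x \<or> \<phi> \<gamma> x = x"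
proof (rule ccontr)
  assume *: "\<not> ?thesis"
  \<comment> \<open>If two of these images agreed, applying \<alpha> or \<beta> to both sides would
    produce a non-identity element fixing \<open>x\<close>. So a trivial stabilizer forces four
    distinct points in the orbit.\<close>
  then have "\<phi> \<alpha> x \<noteq> \<phi> \<beta> x" "\<phi> \<alpha> x \<noteq> \<phi> \<gamma> x" "\<phi> \<beta> x \<noteq> \<phi> \<gamma> x"
    using action_comp[OF assms] action_comp(1)[OF action_closed(2)[OF assms]]
      action_comp(2)[OF action_closed(1)[OF assms]] by fastforce+
  with * have "card (orbit G \<phi> x) = 4"
    by (auto simp: orbit_eq[OF assms])
  moreover have "orbit G \<phi> x \<in> orbits G X \<phi>" using assms by (auto simp: orbits_def)
  ultimately show False using orbit_card_neq_4 by blast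
qed

lemma orbit_of_member:
  assumes "Y \<in> orbits G X \<phi>" "x \<in> Y"
  shows "x \<in> X" "Y = orbit G \<phi> x"
proof -
  show "x \<in> X" using assms orbits_coverture by blast
  then have "orbit G \<phi> x \<in> orbits G X \<phi>" "x \<in> orbit G \<phi> x"
    using orbit_refl by (auto simp: orbits_def)
  then show "Y = orbit G \<phi> x"
    using assms disjoint_union[of Y "orbit G \<phi> x"] by blast
qed

text \<open>Since \<beta> acts trivially on the orbit and \<gamma> is the product of \<alpha> and
  \<beta>, the elements \<alpha> and \<gamma> act alike there; length 2 then forces them to swap its
  points.\<close>

lemma trivial_orbits2_member:
  assumes "Y \<in> trivial_orbits2 G X \<phi> \<beta>" "x \<in> Y"
  shows "x \<in> X" "Y = {x, \<phi> \<alpha> x}" "\<phi> \<alpha> x \<noteq> x" "\<phi> \<beta> x = x" "\<phi> \<gamma> x \<noteq> x"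
proof -
  have Y: "Y \<in> orbits G X \<phi>" "card Y = 2" "\<phi> \<beta> x = x"
    using assms by (auto simp: trivial_orbits2_def)
  show x: "x \<in> X" using orbit_of_member Y(1) assms(2) by blast
  show "\<phi> \<beta> x = x" by fact
  have "\<phi> \<gamma> x = \<phi> \<alpha> x" using action_comp(4)[OF x] Y(3) by simp
  then show "Y = {x, \<phi> \<alpha> x}"
    using orbit_of_member(2)[OF Y(1) assms(2)] orbit_eq[OF x] Y(3) by auto
  then show "\<phi> \<alpha> x \<noteq> x" using Y(2) by auto
  then show "\<phi> \<gamma> x \<noteq> x" using \<open>\<phi> \<gamma> x = \<phi> \<alpha> x\<close> by simp
qed

lemma trivial_orbits2_disjoint:
  "trivial_orbits2 G X \<phi> \<beta> \<inter> trivial_orbits2 G X \<phi> \<gamma> = {}"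
proof -
  have False if Y: "Y \<in> trivial_orbits2 G X \<phi> \<beta>" "Y \<in> trivial_orbits2 G X \<phi> \<gamma>" for Y
  proof -
    have "Y \<noteq> {}" using Y by (auto simp: trivial_orbits2_def)
    then obtain x where x: "x \<in> Y" by blast
    then have "\<phi> \<gamma> x = x" using Y by (auto simp: trivial_orbits2_def)
    then show False using trivial_orbits2_member(5)[OF Y(1) x] by simp
  qed
  then show ?thesis by blast
qed

lemma finite_trivial_orbits2: "finite (trivial_orbits2 G X \<phi> g)"
proof -
  have "orbits G X \<phi> = orbit G \<phi> ` X" by (auto simp: orbits_def)
  then show ?thesis using finite_X by (auto simp: trivial_orbits2_def)
qed

text \<open>Converse to \<open>trivial_orbits2_member\<close>. By commutativity \<beta> also fixes
  \<open>\<phi> \<alpha> x\<close>, hence the whole orbit.\<close>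

lemma nonfixed_in_trivial_orbits2:
  assumes "x \<in> X" "\<phi> \<alpha> x \<noteq> x" "\<phi> \<beta> x = x"
  shows "orbit G \<phi> x \<in> trivial_orbits2 G X \<phi> \<beta>"
proof -
  have "\<phi> \<gamma> x = \<phi> \<alpha> x" using action_comp(4)[OF assms(1)] assms(3) by simp
  then have "orbit G \<phi> x = {x, \<phi> \<alpha> x}" using orbit_eq[OF assms(1)] assms(3) by auto
  moreover have "\<phi> \<beta> (\<phi> \<alpha> x) = \<phi> \<alpha> x"
    using action_comp(5)[OF assms(1)] \<open>\<phi> \<gamma> x = \<phi> \<alpha> x\<close> by simp
  ultimately show ?thesis
    using assms by (auto simp: trivial_orbits2_def orbits_def)
qed

section \<open>Counting the points where \<open>f\<close> changes\<close>

lemma card_derivative_support: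
  fixes f :: "'x \<Rightarrow> bit"
  shows "card {x \<in> X. f (\<phi> \<alpha> x) \<noteq> f x} = 2 * (mu G X \<phi> f \<beta> + mu G X \<phi> f \<gamma>)"
proof -
  \<comment> \<open>Exchanging \<beta> and \<gamma> supplies the facts for orbits on which \<gamma>
    acts trivially.\<close>
  interpret s: klein_four_action G X \<phi> \<alpha> \<gamma> \<beta> by (rule swap)
  define S where "S g = {Y \<in> trivial_orbits2 G X \<phi> g. card (f -` {1} \<inter> Y) = 1}" for g
  have fin: "finite (S g)" for g using finite_trivial_orbits2 by (simp add: S_def)
  have "{x \<in> X. f (\<phi> \<alpha> x) \<noteq> f x} = \<Union>(S \<beta> \<union> S \<gamma>)"
  proof (intro equalityI subsetI)
    fix x assume "x \<in> {x \<in> X. f (\<phi> \<alpha> x) \<noteq> f x}"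
    then have x: "x \<in> X" "f (\<phi> \<alpha> x) \<noteq> f x" "\<phi> \<alpha> x \<noteq> x" by auto
    have xo: "x \<in> orbit G \<phi> x" using orbit_eq[OF x(1)] by blast
    from fixed_by_nonidentity[OF x(1)] x(3) consider "\<phi> \<beta> x = x" | "\<phi> \<gamma> x = x" by blast
    then show "x \<in> \<Union>(S \<beta> \<union> S \<gamma>)"
    proof cases
      case 1
      note t = nonfixed_in_trivial_orbits2[OF x(1,3) 1]
      show ?thesis
        using t xo x card_ones_on_pair_iff[OF trivial_orbits2_member(2)[OF t xo]] by (auto simp: S_def)
    next
      case 2
      note t = s.nonfixed_in_trivial_orbits2[OF x(1,3) 2]
      show ?thesis
        using t xo x card_ones_on_pair_iff[OF s.trivial_orbits2_member(2)[OF t xo]] by (auto simp: S_def)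
    qed
  next
    fix x assume "x \<in> \<Union>(S \<beta> \<union> S \<gamma>)"
    then obtain Y where Y: "x \<in> Y" "card (f -` {1} \<inter> Y) = 1"
      "Y \<in> trivial_orbits2 G X \<phi> \<beta> \<or> Y \<in> trivial_orbits2 G X \<phi> \<gamma>"
      by (auto simp: S_def)
    then have "x \<in> X" "Y = {x, \<phi> \<alpha> x}" "\<phi> \<alpha> x \<noteq> x"
      using trivial_orbits2_member[of Y x] s.trivial_orbits2_member[of Y x] by blast+
    then show "x \<in> {x \<in> X. f (\<phi> \<alpha> x) \<noteq> f x}"
      using card_ones_on_pair_iff[of Y x "\<phi> \<alpha> x" f] Y(2) by auto
  qed
  \<comment> \<open>Distinct orbits are disjoint and each one here has two points, whence the factor
    2.\<close>
  also have "card (\<Union>(S \<beta> \<union> S \<gamma>)) = 2 * card (S \<beta> \<union> S \<gamma>)"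
  proof -
    have S: "Y \<in> orbits G X \<phi>" "card Y = 2" if "Y \<in> S \<beta> \<union> S \<gamma>" for Y
      using that by (auto simp: S_def trivial_orbits2_def)
    have "card (\<Union>(S \<beta> \<union> S \<gamma>)) = (\<Sum>Y\<in>S \<beta> \<union> S \<gamma>. card Y)"
    proof (rule card_Union_disjoint)
      show "pairwise disjnt (S \<beta> \<union> S \<gamma>)"
        using S(1) disjoint_union unfolding pairwise_def disjnt_def by blast
      show "finite Y" if "Y \<in> S \<beta> \<union> S \<gamma>" for Y
        using S(2)[OF that] card.infinite by fastforce
    qed
    then show ?thesis using S(2) by simp
  qed
  also have "card (S \<beta> \<union> S \<gamma>) = mu G X \<phi> f \<beta> + mu G X \<phi> f \<gamma>"
    using fin trivial_orbits2_disjoint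
    by (subst card_Un_disjoint) (auto simp: S_def mu_def)
  finally show ?thesis .
qed

text \<open>The derivative takes only the values 0 and 1, and its two fibres partition
  \<open>X\<close>. Both have half the size of \<open>X\<close> exactly when the fibre over 1
  does.\<close>

lemma derivative_balanced_iff:
  fixes f :: "'x \<Rightarrow> bit"
  shows "(\<forall>\<sigma>. real (card {x \<in> X. f (\<phi> g x) - f x = \<sigma>}) = real (card X) / 2) \<longleftrightarrow>
    2 * card {x \<in> X. f (\<phi> g x) \<noteq> f x} = card X"
proof -
  let ?N = "{x \<in> X. f (\<phi> g x) \<noteq> f x}" and ?E = "{x \<in> X. f (\<phi> g x) = f x}"
  have diff1: "{x \<in> X. f (\<phi> g x) - f x = 1} = ?N"
  proof -
    have "u - v = 1 \<longleftrightarrow> u \<noteq> v" for u v :: bit by (cases u; cases v) auto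
    then show ?thesis by simp
  qed
  have diff0: "{x \<in> X. f (\<phi> g x) - f x = 0} = ?E"
    by (simp only: right_minus_eq)
  have "X = ?N \<union> ?E" by blast
  then have "card X = card ?N + card ?E"
    using finite_X card_Un_disjoint[of ?N ?E] by fastforce
  moreover have "(\<forall>\<sigma>. P \<sigma>) \<longleftrightarrow> P 0 \<and> P 1" for P :: "bit \<Rightarrow> bool"
    by (metis bit.exhaust)
  moreover have "real e = real (n + e) / 2 \<and> real n = real (n + e) / 2 \<longleftrightarrow> 2 * n = n + e"
    for n e :: nat by auto
  ultimately show ?thesis by (simp only: diff0 diff1)
qed

lemma perfect_nonlinear_iff_mu:
  fixes f :: "'x \<Rightarrow> bit"
  shows "perfect_nonlinear G X \<phi> f \<longleftrightarrow>
    8 * mu G X \<phi> f \<alpha> = card X \<and> 8 * mu G X \<phi> f \<beta> = card X \<and> 8 * mu G X \<phi> f \<gamma> = card X"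
    (is "_ \<longleftrightarrow> ?R")
proof -
  interpret b: klein_four_action G X \<phi> \<beta> \<gamma> \<alpha> by (rule rotate)
  interpret c: klein_four_action G X \<phi> \<gamma> \<alpha> \<beta> by (rule b.rotate)
  have nonid: "carrier G - {\<one>} = {\<alpha>, \<beta>, \<gamma>}"
    using carrier_eq distinct_elements by auto
  have "perfect_nonlinear G X \<phi> f \<longleftrightarrow> 2 dvd card X \<and>
      (\<forall>g\<in>{\<alpha>, \<beta>, \<gamma>}. 2 * card {x \<in> X. f (\<phi> g x) \<noteq> f x} = card X)"
    by (simp only: perfect_nonlinear_def nonid derivative_balanced_iff)
  \<comment> \<open>Each condition says that four times the sum of two of the \<open>mu\<close>
    values is \<open>card X\<close>. Comparing the three equations makes the values equal;
    conversely, \<open>card X\<close> being 8 times a natural number also gives its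
    evenness.\<close>
  also have "\<dots> \<longleftrightarrow> ?R"
    using card_derivative_support[of f] b.card_derivative_support[of f]
      c.card_derivative_support[of f] by (auto; presburger)
  finally show ?thesis .
qed

section \<open>Construction of a function and the existence criterion\<close>

lemma exists_function_with_mu:
  assumes "n \<le> card (trivial_orbits2 G X \<phi> \<alpha>)" "n \<le> card (trivial_orbits2 G X \<phi> \<beta>)"
    "n \<le> card (trivial_orbits2 G X \<phi> \<gamma>)"
  shows "\<exists>f :: 'x \<Rightarrow> bit. \<forall>g\<in>{\<alpha>, \<beta>, \<gamma>}. mu G X \<phi> f g = n"
proof -
  interpret b: klein_four_action G X \<phi> \<beta> \<gamma> \<alpha> by (rule rotate)
  interpret c: klein_four_action G X \<phi> \<gamma> \<alpha> \<beta> by (rule b.rotate)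
  let ?T = "trivial_orbits2 G X \<phi>"
  have "\<forall>g\<in>{\<alpha>, \<beta>, \<gamma>}. \<exists>A \<subseteq> ?T g. card A = n"
    using assms by (auto elim: obtain_subset_with_card_n)
  then obtain A where A: "\<And>g. g \<in> {\<alpha>, \<beta>, \<gamma>} \<Longrightarrow> A g \<subseteq> ?T g"
    "\<And>g. g \<in> {\<alpha>, \<beta>, \<gamma>} \<Longrightarrow> card (A g) = n"
    by metis
  define U where "U = A \<alpha> \<union> A \<beta> \<union> A \<gamma>"
  \<comment> \<open>An arbitrary representative of each orbit; \<open>f\<close> is the indicator of
    those of the selected orbits.\<close>
  define s where "s Y = (SOME x. x \<in> Y)" for Y :: "'x set"
  define f :: "'x \<Rightarrow> bit" where "f x = (if x \<in> s ` U then 1 else 0)" for x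
  have orb: "Y \<in> orbits G X \<phi>" "s Y \<in> Y" if "Y \<in> ?T g" for Y g
  proof -
    show "Y \<in> orbits G X \<phi>" using that by (simp add: trivial_orbits2_def)
    have "Y \<noteq> {}" using that by (auto simp: trivial_orbits2_def)
    then show "s Y \<in> Y" by (simp add: s_def some_in_eq)
  qed
  have U_orb: "\<exists>g. Y \<in> ?T g" if "Y \<in> U" for Y
    using that A(1) by (auto simp: U_def)
  have ones: "f -` {1} \<inter> Y = (if Y \<in> U then {s Y} else {})" if Y: "Y \<in> ?T g" for Y g
  proof -
    \<comment> \<open>An orbit is determined by any of its points, so no other selected orbit
      contributes a value 1 on \<open>Y\<close>.\<close>
    have "Z = Y" if Z: "Z \<in> U" "s Z \<in> Y" for Z
      using orbit_of_member(2) orb Y U_orb Z by metis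
    then show ?thesis
      using orb(2)[OF Y] by (cases "Y \<in> U") (fastforce simp: f_def split: if_splits)+
  qed
  have "mu G X \<phi> f g = n" if g: "g \<in> {\<alpha>, \<beta>, \<gamma>}" for g
  proof -
    have "{Y \<in> ?T g. card (f -` {1} \<inter> Y) = 1} = ?T g \<inter> U"
      using ones by (auto split: if_splits)
    \<comment> \<open>The three families of orbits are pairwise disjoint, so the selections for the
      other two elements add nothing here.\<close>
    also have "\<dots> = A g"
      using g A(1) trivial_orbits2_disjoint b.trivial_orbits2_disjoint c.trivial_orbits2_disjoint
      unfolding U_def by blast
    finally show ?thesis using A(2)[OF g] by (simp add: mu_def)
  qed
  then show ?thesis by blast
qed

lemma mu_le: "mu G X \<phi> f g \<le> card (trivial_orbits2 G X \<phi> g)"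
  unfolding mu_def by (rule card_mono[OF finite_trivial_orbits2]) auto

text \<open>Necessity holds because each \<open>mu\<close> counts a subfamily of the corresponding
  orbits; sufficiency prescribes the common value \<open>card X div 8\<close>.\<close>

lemma exists_perfect_nonlinear_iff:
  "(\<exists>f. perfect_nonlinear G X \<phi> f) \<longleftrightarrow> 8 dvd card X \<and>
    card X div 8 \<le> card (trivial_orbits2 G X \<phi> \<alpha>) \<and>
    card X div 8 \<le> card (trivial_orbits2 G X \<phi> \<beta>) \<and>
    card X div 8 \<le> card (trivial_orbits2 G X \<phi> \<gamma>)" (is "?L \<longleftrightarrow> ?R")
proof
  assume ?L
  then obtain f where "8 * mu G X \<phi> f \<alpha> = card X" "8 * mu G X \<phi> f \<beta> = card X"
    "8 * mu G X \<phi> f \<gamma> = card X"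
    using perfect_nonlinear_iff_mu by blast
  then show ?R
    using mu_le[of f \<alpha>] mu_le[of f \<beta>] mu_le[of f \<gamma>] by (auto intro: dvdI[OF sym])
next
  assume ?R
  then obtain f :: "'x \<Rightarrow> bit" where "\<forall>g\<in>{\<alpha>, \<beta>, \<gamma>}. mu G X \<phi> f g = card X div 8"
    using exists_function_with_mu by blast
  with \<open>?R\<close> show ?L
    using perfect_nonlinear_iff_mu[of f] by auto
qed

end

theorem theorem5p4:
  fixes G :: "('g, 'm) monoid_scheme"
    and \<alpha> \<beta> \<gamma> :: 'g
    and X :: "'x set"
    and \<phi> :: "'g \<Rightarrow> 'x \<Rightarrow> 'x"
    and p q r :: nat
  assumes "klein_four_group G"
    and "carrier G = {\<one>\<^bsub>G\<^esub>, \<alpha>, \<beta>, \<gamma>}"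
    and "distinct [\<one>\<^bsub>G\<^esub>, \<alpha>, \<beta>, \<gamma>]"
    and "finite X"
    and "group_action G X \<phi>"
    and "\<forall>Y\<in>orbits G X \<phi>. card Y \<noteq> 4"
    and "p = card (trivial_orbits2 G X \<phi> \<alpha>)"
    and "q = card (trivial_orbits2 G X \<phi> \<beta>)"
    and "r = card (trivial_orbits2 G X \<phi> \<gamma>)"
  shows "((\<exists>f :: 'x \<Rightarrow> bit. perfect_nonlinear G X \<phi> f) \<longleftrightarrow>
            8 dvd card X \<and> real (Min {p, q, r}) \<ge> real (card X) / 8) \<and>
         (\<forall>f :: 'x \<Rightarrow> bit. perfect_nonlinear G X \<phi> f \<longleftrightarrow>
            real (mu G X \<phi> f \<alpha>) = real (card X) / 8 \<and>
            real (mu G X \<phi> f \<beta>) = real (card X) / 8 \<and>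
            real (mu G X \<phi> f \<gamma>) = real (card X) / 8)"
proof -
  interpret group_action G X \<phi> by fact
  interpret klein_four_action G X \<phi> \<alpha> \<beta> \<gamma>
    using assms klein_four_group_square[OF assms(1)] by unfold_locales auto
  have eq: "real m = real (card X) / 8 \<longleftrightarrow> 8 * m = card X" for m
    by auto
  \<comment> \<open>Divisibility by 8 makes the integer quotient agree with the real one.\<close>
  have le: "real (card X) / 8 \<le> real (Min {p, q, r}) \<longleftrightarrow>
      card X div 8 \<le> p \<and> card X div 8 \<le> q \<and> card X div 8 \<le> r" if "8 dvd card X"
    using that by auto
  show ?thesis
    unfolding eq using perfect_nonlinear_iff_mu exists_perfect_nonlinear_iff le assms(7-9) by blast
qed

end
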